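(* Let $(\Delta_n)_{n=1}^{\infty}$ be an arbitrary sequence of closed intervals of positive length contained in $\left[0,\frac{2}{\sqrt{3}}\right]$. Then there exists a set of cardinality of the continuum of vectors $\mathbf{v}\in\mathbb{R}^2$ whose sequence of best approximations $(q_n,\mathbf{p}_n)_{n\geqslant 0}$ is infinite and satisfies $$\frac{1}{\pi}V_n=q_n\,|q_{n-1}\mathbf{v}-\mathbf{p}_{n-1}|^2\in\Delta_n\qquad\text{for all } n\in\mathbb{N}.$$
   Context: For $x\in\mathbb{R}$, $\|x\|$ is the distance from $x$ to the nearest integer, and $|\cdot|$ is the Euclidean norm on $\mathbb{R}^2$. For $\mathbf{v}=(v_1,v_2)\in\mathbb{R}^2$, the sequence of best approximations (Euclidean norm) is defined by: $q_0=1$; $q_{n+1}=\min\{q\in\mathbb{N}: \sqrt{\|qv_1\|^2+\|qv_2\|^2}<\sqrt{\|q_nv_1\|^2+\|q_nv_2\|^2}\}$ (as long as this set is nonempty); and $\mathbf{p}_n=(p_{n,1},p_{n,2})\in\mathbb{Z}^2$ with $|q_nv_1-p_{n,1}|=\|q_nv_1\|$, $|q_nv_2-p_{n,2}|=\|q_nv_2\|$. Thus $|q_n\mathbf{v}-\mathbf{p}_n|=\sqrt{\|q_nv_1\|^2+\|q_nv_2\|^2}$ does not depend on the choice of $\mathbf{p}_n$. For $n\geqslant 1$ set $R_n=|q_{n-1}\mathbf{v}-\mathbf{p}_{n-1}|$ and $V_n=\pi q_n R_n^2$ (the volume of the cylinder $\{(q,\mathbf{p})\in\mathbb{R}\times\mathbb{R}^2: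 0\leqslant q\leqslant q_n,\ |q\mathbf{v}-\mathbf{p}|\leqslant R_n\}$). *)

theory Defs
  imports "HOL-Analysis.Analysis" "HOL-Library.Equipollence"
begin

definition dist_nearest_int :: "real \<Rightarrow> real" where
  "dist_nearest_int x = \<bar>x - of_int (round x)\<bar>"

lemma dist_nearest_int_le: "dist_nearest_int x \<le> \<bar>x - of_int k\<bar>"
  unfolding dist_nearest_int_def by (rule round_diff_minimal)

definition approx_error :: "real ^ 2 \<Rightarrow> nat \<Rightarrow> real" where
  "approx_error v q =
     sqrt ((dist_nearest_int (real q * v $ 1))\<^sup>2 + (dist_nearest_int (real q * v $ 2))\<^sup>2)"

text \<open>The candidates for the next denominator range over the positive integers:
  zero would always have error zero.\<close>

definition better_denoms :: "real ^ 2 \<Rightarrow> nat \<Rightarrow> nat set" where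
  "better_denoms v m = {q. 0 < q \<and> approx_error v q < approx_error v m}"

definition int_vec :: "int ^ 2 \<Rightarrow> real ^ 2" where
  "int_vec p = (\<chi> i. of_int (p $ i))"

text \<open>The sequence \<open>(q n, p n)\<close>, indexed by all natural numbers, is an infinite sequence of
  best approximations of \<open>v\<close>. Membership of \<open>q (Suc n)\<close> in the set of candidates
  says that the recursion never stops. The sequence \<open>q\<close> is determined
  by \<open>v\<close>, whereas \<open>p\<close> need not be, because of possible ties.\<close>

definition infinite_best_approx_seq ::
    "real ^ 2 \<Rightarrow> (nat \<Rightarrow> nat) \<Rightarrow> (nat \<Rightarrow> int ^ 2) \<Rightarrow> bool" where
  "infinite_best_approx_seq v q p \<longleftrightarrow>
     q 0 = 1 \<and>
     (\<forall>n. q (Suc n) \<in> better_denoms v (q n) \<and>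
          (\<forall>m \<in> better_denoms v (q n). q (Suc n) \<le> m)) \<and>
     (\<forall>n. \<bar>real (q n) * v $ 1 - of_int (p n $ 1)\<bar> = dist_nearest_int (real (q n) * v $ 1) \<and>
          \<bar>real (q n) * v $ 2 - of_int (p n $ 2)\<bar> = dist_nearest_int (real (q n) * v $ 2))"

text \<open>The next two notions are meant for indices \<open>n \<ge> 1\<close> only.\<close>

definition cyl_radius ::
    "real ^ 2 \<Rightarrow> (nat \<Rightarrow> nat) \<Rightarrow> (nat \<Rightarrow> int ^ 2) \<Rightarrow> nat \<Rightarrow> real" where
  "cyl_radius v q p n = norm (real (q (n - 1)) *\<^sub>R v - int_vec (p (n - 1)))"

definition cyl_volume ::
    "real ^ 2 \<Rightarrow> (nat \<Rightarrow> nat) \<Rightarrow> (nat \<Rightarrow> int ^ 2) \<Rightarrow> nat \<Rightarrow> real" where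
  "cyl_volume v q p n = pi * real (q n) * (cyl_radius v q p n)\<^sup>2"

end

theory Submission
  imports Defs
begin

text \<open>
  The best approximations are built as integer points with
  \<open>z\<^sub>n\<^sub>+\<^sub>1 = a z\<^sub>n + k z\<^sub>n\<^sub>-\<^sub>1 + z\<^sub>n\<^sub>-\<^sub>2\<close>, so that three consecutive ones always form a basis of the
  integer lattice. Let \<open>w\<close> be the rational vector \<open>p / q\<close> of the new point \<open>(q, p)\<close>. Projecting the
  integer lattice along that point gives a plane lattice of covolume \<open>1 / q\<close> containing the residual
  \<open>x\<close> of \<open>z\<^sub>n\<close>. It lies on lines parallel to \<open>x\<close>, at distance \<open>norm x / c\<close> from each other with
  \<open>c = q * (norm x)\<^sup>2\<close>, and \<open>x\<close> is a shortest vector as soon as \<open>c < 2 / sqrt 3\<close> and neighbouring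
  lines are shifted by about half a period. For large \<open>k\<close> there is a choice of \<open>a\<close> that brings \<open>c\<close>
  into any prescribed interval and the shift close to one half: \<open>a\<close> may range over about \<open>k\<^sup>2\<close>
  values, and each step moves the shift by about \<open>1 / k\<close>. What is achieved at \<open>w\<close> persists on a
  small half disc at \<open>w\<close>, and the next rational vector can be taken inside it. Since \<open>q\<close> can be
  arbitrarily large, there are two choices at every stage, hence a continuum of limits.
\<close>

section \<open>Integer points \<open>(q, p)\<close>, their residuals and lattice bases\<close>

type_synonym lpoint = "int \<times> (int ^ 2)"

definition smul :: "int \<Rightarrow> lpoint \<Rightarrow> lpoint" where
  "smul i z = (i * fst z, i *s snd z)"

text \<open>Up to sign, this is the projection of the point along the line through
  \<open>(1, v)\<close> onto the plane of height 0.\<close>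

definition residual :: "real ^ 2 \<Rightarrow> lpoint \<Rightarrow> real ^ 2" where
  "residual v z = of_int (fst z) *\<^sub>R v - int_vec (snd z)"

definition slope :: "lpoint \<Rightarrow> real ^ 2" where
  "slope z = int_vec (snd z) /\<^sub>R of_int (fst z)"

definition cross2 :: "real ^ 2 \<Rightarrow> real ^ 2 \<Rightarrow> real" where
  "cross2 x y = x $ 1 * y $ 2 - x $ 2 * y $ 1"

text \<open>The 3 by 3 determinant with rows \<open>e\<close>, \<open>f\<close>, \<open>g\<close>,
  expanded along the column of heights.\<close>

definition det3 :: "lpoint \<Rightarrow> lpoint \<Rightarrow> lpoint \<Rightarrow> int" where
  "det3 e f g =
     fst e * (snd f $ 1 * snd g $ 2 - snd f $ 2 * snd g $ 1)
   - fst f * (snd e $ 1 * snd g $ 2 - snd e $ 2 * snd g $ 1)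
   + fst g * (snd e $ 1 * snd f $ 2 - snd e $ 2 * snd f $ 1)"

definition lattice_basis :: "lpoint \<Rightarrow> lpoint \<Rightarrow> lpoint \<Rightarrow> bool" where
  "lattice_basis e f g \<longleftrightarrow>
     det3 e f g = 1 \<and> (\<forall>z. \<exists>i j l. z = smul i e + smul j f + smul l g)"

text \<open>The last clause includes the height \<open>fst e\<close> itself, so \<open>snd e\<close>
  is forced to be a nearest integer vector. Ties are allowed.\<close>

definition successive :: "real ^ 2 \<Rightarrow> lpoint \<Rightarrow> lpoint \<Rightarrow> bool" where
  "successive v e e' \<longleftrightarrow>
     0 < fst e \<and> fst e < fst e' \<and> norm (residual v e') < norm (residual v e) \<and>
     (\<forall>z. 0 < fst z \<longrightarrow> fst z < fst e' \<longrightarrow> norm (residual v e) \<le> norm (residual v z))"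

lemma fst_smul [simp]: "fst (smul i z) = i * fst z"
  by (simp add: smul_def)

lemma int_vec_nth [simp]: "int_vec p $ i = of_int (p $ i)"
  by (simp add: int_vec_def)

lemma residual_add: "residual v (z + z') = residual v z + residual v z'"
  by (simp add: residual_def vec_eq_iff algebra_simps)

lemma residual_smul: "residual v (smul i z) = of_int i *\<^sub>R residual v z"
  by (simp add: residual_def smul_def vec_eq_iff algebra_simps)

lemma residual_shift: "residual v z = residual w z + of_int (fst z) *\<^sub>R (v - w)"
  by (simp add: residual_def algebra_simps)

lemma residual_slope: "fst z \<noteq> 0 \<Longrightarrow> residual (slope z) z = 0"
  by (simp add: residual_def slope_def)

lemma norm_squared_2: "(norm (x :: real ^ 2))\<^sup>2 = (x $ 1)\<^sup>2 + (x $ 2)\<^sup>2"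
  unfolding power2_norm_eq_inner inner_vec_def sum_2 by (simp add: power2_eq_square)

text \<open>Lagrange's identity in the plane.\<close>

lemma inner_cross2_squared: "(inner x y)\<^sup>2 + (cross2 x y)\<^sup>2 = (norm x)\<^sup>2 * (norm y)\<^sup>2"
  unfolding norm_squared_2 cross2_def inner_vec_def sum_2 by (simp add: power2_eq_square algebra_simps)

text \<open>Projecting a lattice of covolume 1 along \<open>e\<close> leaves a plane lattice of
  signed covolume \<open>1 / fst e\<close>: multiplied by \<open>fst e\<close>, the cross product
  expands to the determinant.\<close>

lemma cross2_residual_slope:
  assumes "lattice_basis e f g" "fst e \<noteq> 0"
  shows "cross2 (residual (slope e) f) (residual (slope e) g) = 1 / of_int (fst e)"
proof -
  let ?q = "real_of_int (fst e)"
  have q: "?q \<noteq> 0" using assms by simp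
  have d: "real_of_int (det3 e f g) = 1"
    using assms by (simp add: lattice_basis_def)
  have "?q * cross2 (residual (slope e) f) (residual (slope e) g) = of_int (det3 e f g)"
    using q by (simp add: cross2_def residual_def slope_def det3_def field_simps)
  then show ?thesis using q d by (simp add: field_simps)
qed

text \<open>Adding multiples of \<open>e\<close> and \<open>f\<close> to \<open>g\<close> and
  permuting cyclically keeps the determinant, and the change of coordinates is integral in both
  directions.\<close>

lemma lattice_basis_step:
  assumes "lattice_basis e f g"
  shows "lattice_basis (smul a e + smul k f + g) e f"
proof -
  let ?e' = "smul a e + smul k f + g"
  have "det3 ?e' e f = det3 e f g"
    by (simp add: det3_def smul_def algebra_simps)
  moreover have "\<exists>i j l. z = smul i ?e' + smul j e + smul l f" for z
  proof -
    obtain i j l where "z = smul i e + smul j f + smul l g"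
      using assms unfolding lattice_basis_def by blast
    then have "z = smul l ?e' + smul (i - l * a) e + smul (j - l * k) f"
      by (simp add: smul_def prod_eq_iff vec_eq_iff algebra_simps)
    then show ?thesis by blast
  qed
  ultimately show ?thesis using assms by (simp add: lattice_basis_def)
qed

section \<open>Plane lattices: vectors off a line, and shifts modulo 1\<close>

text \<open>In units of \<open>norm x\<close>, the vector \<open>j x + l y\<close> has squared
  length \<open>(j + l \<tau>)^2 + l^2 h^2\<close> with \<open>h = 1 / c\<close>. A factor
  \<open>\<kappa>\<close> uniform in \<open>j\<close> and \<open>l\<close> is what makes the gap
  survive a perturbation of \<open>v\<close>.\<close>

lemma off_line_gap:
  fixes x y :: "real ^ 2"
  assumes x: "x \<noteq> 0" and cr: "cross2 x y = (norm x)\<^sup>2 / c" and c: "0 < c"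
    and rho: "0 \<le> \<rho>" "\<rho> \<le> 1 / 2" "\<rho> < 1 / c\<^sup>2 - 3 / 4"
    and tau: "\<bar>inner x y / (norm x)\<^sup>2 - of_int i0 - 1 / 2\<bar> \<le> \<rho>"
  obtains \<kappa> where "1 < \<kappa>"
    "\<And>j l :: int. l \<noteq> 0 \<Longrightarrow> \<kappa> * norm x \<le> norm (of_int j *\<^sub>R x + of_int l *\<^sub>R y)"
proof -
  define N where "N = (norm x)\<^sup>2"
  have N: "0 < N" using x by (simp add: N_def)
  define \<tau> where "\<tau> = inner x y / N"
  define h where "h = 1 / c"
  have h: "3 / 4 + \<rho> < h\<^sup>2" using rho by (simp add: h_def power_divide)
  \<comment> \<open>The bound 3 serves the lines with |l| at least 2, the other one the two
    neighbouring lines.\<close>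
  define m where "m = min 3 ((1 / 2 - \<rho>)\<^sup>2 + h\<^sup>2)"
  have "(1 / 2 - \<rho>)\<^sup>2 = 1 / 4 - \<rho> + \<rho>\<^sup>2" by (simp add: power2_diff power_divide)
  then have "1 < (1 / 2 - \<rho>)\<^sup>2 + h\<^sup>2"
    using h zero_le_power2[of \<rho>] by linarith
  then have m: "1 < m" by (simp add: m_def)
  have id: "(norm (a *\<^sub>R x + b *\<^sub>R y))\<^sup>2 = N * ((a + b * \<tau>)\<^sup>2 + b\<^sup>2 * h\<^sup>2)" for a b :: real
  proof -
    have ny: "N * (norm y)\<^sup>2 = (N * \<tau>)\<^sup>2 + (N * h)\<^sup>2"
      using inner_cross2_squared[of x y] N cr by (simp add: \<tau>_def h_def N_def)
    have ny': "(norm y)\<^sup>2 = N * \<tau>\<^sup>2 + N * h\<^sup>2"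
    proof -
      have "N * (norm y)\<^sup>2 = N * (N * \<tau>\<^sup>2 + N * h\<^sup>2)"
        unfolding ny by (simp add: power2_eq_square algebra_simps)
      then show ?thesis using N by simp
    qed
    have xy: "inner x y = N * \<tau>" using N by (simp add: \<tau>_def)
    have "(norm (a *\<^sub>R x + b *\<^sub>R y))\<^sup>2 = a\<^sup>2 * N + 2 * a * b * inner x y + b\<^sup>2 * (norm y)\<^sup>2"
      unfolding N_def power2_norm_eq_inner
      by (simp add: inner_add inner_commute power2_eq_square algebra_simps)
    then show ?thesis unfolding xy ny' by (simp add: power2_eq_square algebra_simps)
  qed
  have key: "m \<le> (of_int j + of_int l * \<tau>)\<^sup>2 + (of_int l)\<^sup>2 * h\<^sup>2" if l: "l \<noteq> 0" for j l :: int
  proof (cases "\<bar>l\<bar> = 1")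
    case True
    have "1 / 2 - \<rho> \<le> \<bar>of_int j + of_int l * \<tau>\<bar>"
    proof -
      have t: "\<bar>\<tau> - of_int i0 - 1 / 2\<bar> \<le> \<rho>" using tau by (simp add: \<tau>_def N_def)
      have st: "1 / 2 - \<rho> \<le> \<bar>of_int i + \<tau>\<bar>" for i :: int
      proof -
        \<comment> \<open>No integer lies strictly between -1 and 0, so \<open>i + i0 + 1/2\<close>
          has absolute value at least 1/2.\<close>
        have "i + i0 \<ge> 0 \<or> i + i0 \<le> -1" by linarith
        then have "real_of_int i + of_int i0 \<ge> 0 \<or> real_of_int i + of_int i0 \<le> -1"
          by linarith
        then show ?thesis using t rho by linarith
      qed
      from True consider "l = 1" | "l = -1" by linarith
      then show ?thesis
      proof cases
        case 1 then show ?thesis using st[of j] by simp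
      next
        case 2 then show ?thesis using st[of "-j"] by (simp add: abs_minus_commute)
      qed
    qed
    then have "(1 / 2 - \<rho>)\<^sup>2 \<le> (of_int j + of_int l * \<tau>)\<^sup>2"
      using rho by (metis abs_ge_zero diff_ge_0_iff_ge power2_abs power_mono)
    moreover have "(real_of_int l)\<^sup>2 = 1" using True
      by (metis of_int_1 of_int_abs power2_abs one_power2)
    ultimately show ?thesis by (simp add: m_def min_def)
  next
    case False
    then have "2 \<le> \<bar>real_of_int l\<bar>" using l by linarith
    then have "4 \<le> (real_of_int l)\<^sup>2"
      using power_mono[of 2 "\<bar>real_of_int l\<bar>" 2] by simp
    then have "4 * (3 / 4) \<le> (real_of_int l)\<^sup>2 * h\<^sup>2" using h rho
      by (intro mult_mono) auto
    then have "3 \<le> (of_int j + of_int l * \<tau>)\<^sup>2 + (of_int l)\<^sup>2 * h\<^sup>2"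
      using zero_le_power2[of "of_int j + of_int l * \<tau>"] by linarith
    then show ?thesis by (simp add: m_def)
  qed
  show ?thesis
  proof
    show "1 < sqrt m" using m by simp
    show "sqrt m * norm x \<le> norm (of_int j *\<^sub>R x + of_int l *\<^sub>R y)" if "l \<noteq> 0" for j l :: int
    proof (rule power2_le_imp_le)
      have "(sqrt m * norm x)\<^sup>2 = N * m" using m by (simp add: power_mult_distrib N_def)
      also have "\<dots> \<le> (norm (of_int j *\<^sub>R x + of_int l *\<^sub>R y))\<^sup>2"
        unfolding id using key[OF that] N by (intro mult_left_mono) auto
      finally show "(sqrt m * norm x)\<^sup>2 \<le> (norm (of_int j *\<^sub>R x + of_int l *\<^sub>R y))\<^sup>2" .
    qed simp
  qed
qed

text \<open>Steps of length \<open>\<theta> \<le> \<rho>\<close> around the circle cannot jump over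
  the target. One full turn and one rounding step have total length below 2, hence the hypothesis on
  \<open>L * \<theta>\<close>.\<close>

lemma exists_multiple_near_half_integer:
  fixes \<theta> \<rho> A L \<tau> :: real
  assumes "0 < \<theta>" "\<theta> \<le> \<rho>" "\<rho> < 1" "2 \<le> L * \<theta>"
  obtains a i :: int where "A < of_int a" "of_int a < A + L" "\<bar>\<tau> - of_int a * \<theta> - of_int i - 1 / 2\<bar> \<le> \<rho>"
proof -
  \<comment> \<open>This \<open>i\<close> places the target in the window from
    \<open>A * \<theta>\<close> to \<open>A * \<theta> + 1\<close>; then \<open>x\<close> hits it
    exactly and \<open>a\<close> rounds \<open>x\<close> up.\<close>
  define i where "i = \<lceil>\<tau> - 1 / 2 - A * \<theta>\<rceil> - 1"
  define x where "x = (\<tau> - 1 / 2 - of_int i) / \<theta>"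
  define a where "a = \<lfloor>x\<rfloor> + 1"
  have i: "A * \<theta> < \<tau> - 1 / 2 - of_int i" "\<tau> - 1 / 2 - of_int i \<le> A * \<theta> + 1"
    unfolding i_def by linarith+
  have xt: "x * \<theta> = \<tau> - 1 / 2 - of_int i" using assms by (simp add: x_def)
  have a: "x < of_int a" "of_int a \<le> x + 1" unfolding a_def by linarith+
  have "A < x" using i(1) assms by (simp add: x_def field_simps)
  then have "A < of_int a" using a by linarith
  moreover have "of_int a * \<theta> < (A + L) * \<theta>"
  proof -
    have "of_int a * \<theta> \<le> (x + 1) * \<theta>" using a assms by (intro mult_right_mono) auto
    then show ?thesis using xt i assms by (simp add: algebra_simps)
  qed
  then have "of_int a < A + L" using assms by simp
  moreover have "x * \<theta> \<le> of_int a * \<theta>" "of_int a * \<theta> \<le> (x + 1) * \<theta>"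
    using a assms by (auto intro!: mult_right_mono)
  then have "\<bar>\<tau> - of_int a * \<theta> - of_int i - 1 / 2\<bar> \<le> \<rho>"
    using xt assms(2) by (simp only: distrib_right mult_1 abs_le_iff) linarith
  ultimately show ?thesis using that by blast
qed

section \<open>Stability near a rational vector\<close>

text \<open>At \<open>w\<close> the point \<open>e'\<close> projects to 0, so residuals there are
  the vectors \<open>j x + l y\<close>. All except 0 and \<open>x\<close>, \<open>-x\<close> are
  longer than \<open>x\<close> by a fixed factor. Below the height of \<open>e'\<close> this leaves
  only \<open>e\<close> and \<open>e' - e\<close> as rivals, and the half-plane condition settles
  their tie.\<close>

lemma successive_near_slope:
  fixes e e' f :: lpoint and c \<rho> \<alpha> \<beta> :: real and i0 :: int
  defines "w \<equiv> slope e'"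
  defines "x \<equiv> residual w e" and "y \<equiv> residual w f"
  assumes basis: "lattice_basis e' e f" and q: "0 < fst e" "2 * fst e \<le> fst e'"
    and c: "c = of_int (fst e') * (norm x)\<^sup>2" "0 < c" "\<alpha> < c" "c < \<beta>"
    and rho: "0 \<le> \<rho>" "\<rho> \<le> 1 / 2" "\<rho> < 1 / c\<^sup>2 - 3 / 4"
    and tau: "\<bar>inner x y / (norm x)\<^sup>2 - of_int i0 - 1 / 2\<bar> \<le> \<rho>"
  obtains \<epsilon> where "0 < \<epsilon>"
    "\<And>v. norm (v - w) \<le> \<epsilon> \<Longrightarrow> inner (v - w) x \<le> 0 \<Longrightarrow> successive v e e'"
    "\<And>v. norm (v - w) \<le> \<epsilon> \<Longrightarrow> of_int (fst e') * (norm (residual v e))\<^sup>2 \<in> {\<alpha>..\<beta>}"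
proof -
  define Q where "Q = real_of_int (fst e')"
  define X where "X = norm x"
  have Q: "0 < Q" "2 * of_int (fst e) \<le> Q" using q by (simp_all add: Q_def)
  have x: "x \<noteq> 0" and X: "0 < X" using c by (auto simp: X_def)
  have "cross2 x y = (norm x)\<^sup>2 / c"
    using cross2_residual_slope[OF basis] q x by (simp add: w_def x_def y_def c(1))
  from off_line_gap[OF x this \<open>0 < c\<close> rho tau]
  obtain \<kappa> where \<kappa>: "1 < \<kappa>"
    and off: "\<And>j l :: int. l \<noteq> 0 \<Longrightarrow> \<kappa> * X \<le> norm (of_int j *\<^sub>R x + of_int l *\<^sub>R y)"
    unfolding X_def by metis
  \<comment> \<open>The cap 2 covers the multiples of \<open>x\<close> with |j| at least 2, and
    bounds the gap \<open>(\<mu> - 1) * X\<close> by \<open>X\<close>.\<close>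
  define \<mu> where "\<mu> = min \<kappa> 2"
  have \<mu>: "1 < \<mu>" "\<mu> \<le> 2" "\<mu> \<le> \<kappa>" using \<kappa> by (auto simp: \<mu>_def)
  have w0: "residual w e' = 0" using q by (simp add: w_def residual_slope)
  have "continuous_on UNIV (\<lambda>v. Q * (norm (residual v e))\<^sup>2)"
    unfolding residual_def by (intro continuous_intros)
  then have "open ((\<lambda>v. Q * (norm (residual v e))\<^sup>2) -` {\<alpha><..<\<beta>})"
    by (intro open_vimage) auto
  moreover have "w \<in> (\<lambda>v. Q * (norm (residual v e))\<^sup>2) -` {\<alpha><..<\<beta>}"
    using c by (simp add: Q_def x_def)
  ultimately obtain \<epsilon>\<^sub>1 where e1: "0 < \<epsilon>\<^sub>1"
    "cball w \<epsilon>\<^sub>1 \<subseteq> (\<lambda>v. Q * (norm (residual v e))\<^sup>2) -` {\<alpha><..<\<beta>}"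
    using open_contains_cball by meson
  \<comment> \<open>Within this radius, residuals of points below height \<open>Q\<close> move by at
    most half the gap, and that of \<open>e\<close> by a quarter because
    \<open>2 * fst e \<le> fst e'\<close>.\<close>
  define \<epsilon> where "\<epsilon> = min \<epsilon>\<^sub>1 ((\<mu> - 1) * X / (2 * Q))"
  show ?thesis
  proof
    show "0 < \<epsilon>" using e1 \<mu> X Q by (simp add: \<epsilon>_def)
  next
    fix v assume "norm (v - w) \<le> \<epsilon>"
    then have "v \<in> cball w \<epsilon>\<^sub>1" by (simp add: \<epsilon>_def dist_norm norm_minus_commute)
    then show "of_int (fst e') * (norm (residual v e))\<^sup>2 \<in> {\<alpha>..\<beta>}"
      using e1(2) by (auto simp: Q_def)
  next
    fix v assume small: "norm (v - w) \<le> \<epsilon>" and half: "inner (v - w) x \<le> 0"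
    define d where "d = v - w"
    have "Q * norm d \<le> Q * ((\<mu> - 1) * X / (2 * Q))"
      using small Q by (intro mult_left_mono) (auto simp: d_def \<epsilon>_def)
    then have Qd: "2 * (Q * norm d) \<le> (\<mu> - 1) * X" using Q by simp
    have "(\<mu> - 1) * X \<le> 1 * X" using \<mu> X by (intro mult_right_mono) auto
    then have Qd2: "2 * (Q * norm d) \<le> X" using Qd by simp
    have qd: "of_int (fst e) * norm d \<le> Q * norm d / 2"
      using mult_right_mono[OF Q(2), of "norm d"] by simp
    have rv: "residual v z = residual w z + of_int (fst z) *\<^sub>R d" for z
      using residual_shift[of v z w] by (simp add: d_def)
    have rv': "norm (residual v e') = Q * norm d" using Q by (simp add: rv w0 Q_def)
    have up: "norm (residual v e) \<le> X + Q * norm d / 2"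
      using norm_triangle_ineq[of x "of_int (fst e) *\<^sub>R d"] qd q
      by (simp add: rv x_def X_def)
    have lo: "X - Q * norm d / 2 \<le> norm (residual v e)"
      using norm_diff_ineq[of x "of_int (fst e) *\<^sub>R d"] qd q
      by (simp add: rv x_def X_def)
    have far: "norm (residual v e) \<le> norm (residual v z)"
      if z: "0 < fst z" "fst z < fst e'" and "\<mu> * X \<le> norm (residual w z)" for z
    proof -
      have "of_int (fst z) * norm d \<le> Q * norm d"
        using z by (intro mult_right_mono) (auto simp: Q_def)
      then have "\<mu> * X - Q * norm d \<le> norm (residual v z)"
        using norm_diff_ineq[of "residual w z" "of_int (fst z) *\<^sub>R d"] that by (simp add: rv)
      moreover have "0 \<le> Q * norm d" using Q by simp
      ultimately show ?thesis using up Qd unfolding left_diff_distrib by linarith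
    qed
    have "norm (residual v e) \<le> norm (residual v z)" if z: "0 < fst z" "fst z < fst e'" for z
    proof -
      obtain i j l where zz: "z = smul i e' + smul j e + smul l f"
        using basis unfolding lattice_basis_def by blast
      have wz: "residual w z = of_int j *\<^sub>R x + of_int l *\<^sub>R y"
        by (simp add: zz residual_add residual_smul w0 x_def y_def)
      consider "l \<noteq> 0" | "l = 0" "2 \<le> \<bar>j\<bar>" | "l = 0" "j = 0" | "l = 0" "j = 1" | "l = 0" "j = -1"
        by linarith
      then show ?thesis
      proof cases
        case 1
        have "\<mu> * X \<le> \<kappa> * X" using \<mu> X by simp
        then show ?thesis using far[OF z] off[OF 1, of j] wz by simp
      next
        case 2
        then have "\<mu> \<le> \<bar>real_of_int j\<bar>" using \<mu> by linarith
        then have "\<mu> * X \<le> \<bar>real_of_int j\<bar> * X" using X by simp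
        then show ?thesis using far[OF z] wz 2 by (simp add: X_def)
      next
        case 3
        then have "0 < i * fst e'" "i * fst e' < 1 * fst e'" using z by (simp_all add: zz smul_def)
        then show ?thesis using q by (simp add: zero_less_mult_iff)
      next
        case 4
        then have "fst z = i * fst e' + fst e" by (simp add: zz)
        then have "-1 * fst e' < i * fst e'" "i * fst e' < 1 * fst e'"
          using z q by linarith+
        then have "i = 0" using q by (simp only: mult_less_cancel_right) auto
        then show ?thesis using 4 by (simp add: zz residual_add residual_smul)
      next
        case 5
        then have "fst z = i * fst e' - fst e" by (simp add: zz)
        then have "0 * fst e' < i * fst e'" "i * fst e' < 2 * fst e'"
          using z q by linarith+
        then have "i = 1" using q by (simp only: mult_less_cancel_right) auto
        then have r: "residual v z = residual v e' - residual v e"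
          using 5 by (simp add: zz residual_add residual_smul)
        \<comment> \<open>The claim for \<open>z = e' - e\<close> amounts to twice this inner
          product being at most \<open>norm (residual v e') ^ 2\<close>. The first term is
          nonpositive on the half disc, the second is at most half of that square.\<close>
        have "inner (residual v e') (residual v e) = Q * inner d x + Q * of_int (fst e) * (norm d)\<^sup>2"
          by (simp add: rv w0 x_def Q_def inner_add power2_norm_eq_inner algebra_simps)
        moreover have "Q * inner d x \<le> 0" using half Q by (simp add: d_def mult_le_0_iff)
        moreover have "(2 * of_int (fst e)) * (Q * (norm d)\<^sup>2) \<le> Q * (Q * (norm d)\<^sup>2)"
          using Q by (intro mult_right_mono) auto
        ultimately have "2 * inner (residual v e') (residual v e) \<le> (norm (residual v e'))\<^sup>2"
          unfolding rv' by (simp add: power2_eq_square algebra_simps)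
        then have "(norm (residual v e))\<^sup>2 \<le> (norm (residual v z))\<^sup>2"
          unfolding r power2_norm_eq_inner by (simp add: inner_diff inner_commute)
        then show ?thesis by (rule power2_le_imp_le) simp
      qed
    qed
    moreover have "norm (residual v e') < norm (residual v e)"
      using rv' lo Qd2 X by linarith
    ultimately show "successive v e e'" using q by (simp add: successive_def)
  qed
qed

text \<open>At \<open>slope e\<close> itself the points \<open>f\<close> and \<open>e - f\<close> have residuals of equal length; the inner
  product condition ensures that \<open>e - f\<close> does not become the better approximation.\<close>

definition region :: "lpoint \<Rightarrow> lpoint \<Rightarrow> real \<Rightarrow> (real ^ 2) set" where
  "region e f \<epsilon> =
     {v. norm (v - slope e) < \<epsilon> \<and> inner (v - slope e) (residual (slope e) f) < 0}"

lemma open_region: "open (region e f \<epsilon>)"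
  unfolding region_def by (intro open_Collect_conj open_Collect_less continuous_intros)

section \<open>The inductive step: choosing the next integer point\<close>

text \<open>For \<open>e' = a e + k f + g\<close>, the shift is affine in \<open>a\<close> with
  slope \<open>-\<theta>\<close>, where \<open>\<theta>\<close> is of order \<open>1 / k\<close>,
  while the admissible range \<open>L\<close> of \<open>a\<close> is of order \<open>k^2\<close>. So
  \<open>L * \<theta>\<close> reaches 2 for large \<open>k\<close>.\<close>

lemma next_point_exists:
  fixes e f g :: lpoint and \<alpha> \<beta> \<epsilon> :: real and N :: int
  assumes basis: "lattice_basis e f g" and q: "0 < fst e" and eps: "0 < \<epsilon>"
    and ab: "0 \<le> \<alpha>" "\<alpha> < \<beta>" "\<beta> \<le> 2 / sqrt 3"
  obtains e' \<epsilon>' where "lattice_basis e' e f" "N < fst e'" "0 < fst e'" "0 < \<epsilon>'"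
    "cball (slope e') \<epsilon>' \<subseteq> region e f \<epsilon>"
    "\<And>v. v \<in> region e' e \<epsilon>' \<Longrightarrow>
      successive v e e' \<and> of_int (fst e') * (norm (residual v e))\<^sup>2 \<in> {\<alpha>..\<beta>}"
proof -
  \<comment> \<open>The middle third keeps \<open>c\<close> strictly inside the interval: positive
    even if \<open>\<alpha> = 0\<close>, and away from \<open>2 / sqrt 3\<close>, which leaves room
    for a positive \<open>\<rho>\<close>.\<close>
  define c1 where "c1 = (2 * \<alpha> + \<beta>) / 3"
  define c2 where "c2 = (\<alpha> + 2 * \<beta>) / 3"
  have cc: "\<alpha> < c1" "0 < c1" "c1 < c2" "c2 < \<beta>" using ab by (auto simp: c1_def c2_def)
  \<comment> \<open>The height of \<open>e'\<close> will be proportional to \<open>1 / c\<close>, so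
    \<open>J\<close> governs the range of \<open>a\<close>.\<close>
  define J where "J = 1 / c1 - 1 / c2"
  have J: "0 < J" using cc by (simp add: J_def field_simps)
  have "c2\<^sup>2 < (2 / sqrt 3)\<^sup>2" using cc ab by (intro power_strict_mono) auto
  then have "c2\<^sup>2 < 4 / 3" by (simp add: power_divide)
  then have H: "0 < 1 / c2\<^sup>2 - 3 / 4" using cc by (simp add: field_simps)
  define \<rho> where "\<rho> = min (1 / 2) (1 / c2\<^sup>2 - 3 / 4)"
  have rho: "0 < \<rho>" "\<rho> \<le> 1 / 2" "\<rho> \<le> 1 / c2\<^sup>2 - 3 / 4" using H unfolding \<rho>_def by linarith+
  have rho1: "\<rho> < 1" using rho by linarith
  define Q where "Q = real_of_int (fst e)"
  have Q: "0 < Q" using q by (simp add: Q_def)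
  define w where "w = slope e"
  define A where "A = residual w f"
  define B where "B = residual w g"
  have we: "residual w e = 0" using q by (simp add: w_def residual_slope)
  have "cross2 A B \<noteq> 0" using cross2_residual_slope[OF basis] q by (simp add: A_def B_def w_def)
  then have A: "A \<noteq> 0" by (auto simp: cross2_def)
  \<comment> \<open>A lower bound for \<open>norm Y\<close>. Its summands ensure in turn
    \<open>norm Y \<ge> 1\<close>, \<open>\<theta> \<le> \<rho>\<close>, a height above
    \<open>N\<close> and \<open>2 * Q\<close>, and a slope within \<open>\<epsilon>\<close> of
    \<open>w\<close>.\<close>
  define T where "T = 1 + norm A / \<rho> + c2 * (\<bar>of_int N\<bar> + 2 * Q) / Q\<^sup>2 + c2 / (Q\<^sup>2 * \<epsilon>)"
  have T: "1 \<le> T" "norm A / \<rho> \<le> T" "c2 * (\<bar>of_int N\<bar> + 2 * Q) / Q\<^sup>2 \<le> T" "c2 / (Q\<^sup>2 * \<epsilon>) < T"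
    using rho cc Q eps by (simp_all add: T_def add_nonneg_nonneg add_pos_nonneg)
  \<comment> \<open>A lower bound for \<open>inner A Y\<close>: it gives positivity,
    \<open>norm Y \<ge> T\<close> by Cauchy-Schwarz, and
    \<open>L * \<theta> \<ge> 2\<close>.\<close>
  define X where "X = 1 + T * norm A + 2 / (Q * J)"
  define k where "k = \<lceil>(X - inner A B) / (norm A)\<^sup>2\<rceil>"
  define Y where "Y = of_int k *\<^sub>R A + B"
  have AY: "X \<le> inner A Y"
  proof -
    have "(X - inner A B) / (norm A)\<^sup>2 \<le> of_int k" unfolding k_def by linarith
    then have "X - inner A B \<le> of_int k * (norm A)\<^sup>2" using A by (simp add: pos_divide_le_eq)
    then show ?thesis by (simp add: Y_def inner_add power2_norm_eq_inner)
  qed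
  have X: "0 < X" "T * norm A \<le> X" "2 / (Q * J) \<le> X"
    using T Q J by (simp_all add: X_def add_pos_nonneg add_nonneg_nonneg)
  have "T * norm A \<le> norm Y * norm A"
    using AY X norm_cauchy_schwarz[of A Y] by (simp add: mult.commute)
  then have TY: "T \<le> norm Y" using A by simp
  have Y: "1 \<le> norm Y" using TY T by linarith
  have Y0: "Y \<noteq> 0" using Y by auto
  define \<theta> where "\<theta> = inner A Y / (norm Y)\<^sup>2"
  have th: "0 < \<theta>" "\<theta> \<le> \<rho>"
  proof -
    show "0 < \<theta>" using AY X Y by (auto simp: \<theta>_def intro!: divide_pos_pos)
    have "inner A Y \<le> norm A * norm Y" by (rule norm_cauchy_schwarz)
    also have "\<dots> \<le> (\<rho> * norm Y) * norm Y"
    proof (rule mult_right_mono)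
      have "norm A / \<rho> \<le> norm Y" using T(2) TY by linarith
      then show "norm A \<le> \<rho> * norm Y" using rho by (simp add: field_simps)
    qed simp
    finally have "inner A Y \<le> \<rho> * (norm Y)\<^sup>2" by (simp add: power2_eq_square)
    moreover have "0 < (norm Y)\<^sup>2" using Y by (intro zero_less_power) linarith
    ultimately show "\<theta> \<le> \<rho>" unfolding \<theta>_def by (simp only: pos_divide_le_eq)
  qed
  define L where "L = Q * (norm Y)\<^sup>2 * J"
  have "2 \<le> L * \<theta>"
  proof -
    have "L * \<theta> = Q * J * inner A Y" using Y by (simp add: L_def \<theta>_def)
    moreover have "2 / (Q * J) \<le> inner A Y" using X AY by linarith
    ultimately show ?thesis using Q J by (simp add: field_simps)
  qed
  define s where "s = of_int k * real_of_int (fst f) + real_of_int (fst g)"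
  \<comment> \<open>The bounds on \<open>a\<close> translate \<open>c1 < c < c2\<close> through
    \<open>Q' = a Q + s\<close>; the last condition is the shift of \<open>f\<close> against
    \<open>e\<close> at the new slope.\<close>
  obtain a i where a: "(Q\<^sup>2 * (norm Y)\<^sup>2 / c2 - s) / Q < of_int a"
    "of_int a < (Q\<^sup>2 * (norm Y)\<^sup>2 / c2 - s) / Q + L"
    and tau: "\<bar>(of_int (fst f) / Q - s / Q * \<theta>) - of_int a * \<theta> - of_int i - 1 / 2\<bar> \<le> \<rho>"
    using exists_multiple_near_half_integer[OF th _ \<open>2 \<le> L * \<theta>\<close>] rho1 by blast
  define e' where "e' = smul a e + smul k f + g"
  define Q' where "Q' = real_of_int (fst e')"
  define w' where "w' = slope e'"
  have Q'eq: "Q' = of_int a * Q + s" by (simp add: Q'_def e'_def Q_def s_def)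
  have Q'1: "Q\<^sup>2 * (norm Y)\<^sup>2 / c2 < Q'" using a(1) Q by (simp add: Q'eq field_simps)
  have Q'2: "Q' < Q\<^sup>2 * (norm Y)\<^sup>2 / c1"
  proof -
    have "(Q\<^sup>2 * (norm Y)\<^sup>2 / c2 - s) / Q + L = (Q\<^sup>2 * (norm Y)\<^sup>2 / c1 - s) / Q"
      using Q cc by (simp add: L_def J_def field_simps power2_eq_square)
    then show ?thesis using a(2) Q by (simp add: Q'eq field_simps)
  qed
  have YY: "norm Y \<le> (norm Y)\<^sup>2" using Y self_le_power[of "norm Y" 2] by simp
  have big: "\<bar>of_int N\<bar> + 2 * Q < Q'"
  proof -
    have "c2 * (\<bar>of_int N\<bar> + 2 * Q) / Q\<^sup>2 \<le> (norm Y)\<^sup>2" using T TY YY by linarith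
    then have "\<bar>of_int N\<bar> + 2 * Q \<le> Q\<^sup>2 * (norm Y)\<^sup>2 / c2" using Q cc by (simp add: field_simps)
    then show ?thesis using Q'1 by linarith
  qed
  have Q': "0 < Q'" using big Q by linarith
  have basis': "lattice_basis e' e f" unfolding e'_def by (rule lattice_basis_step[OF basis])
  have "residual w e' = Y"
    by (simp add: e'_def residual_add residual_smul we Y_def A_def B_def)
  moreover have "residual w' e' = 0" using Q' by (simp add: w'_def residual_slope Q'_def)
  ultimately have "Y + Q' *\<^sub>R (w' - w) = 0"
    using residual_shift[of w' e' w] by (simp add: Q'_def)
  then have wwQ: "Q' *\<^sub>R (w' - w) = - Y" by (simp add: eq_neg_iff_add_eq_0 add.commute)
  have "w' - w = (1 / Q') *\<^sub>R (Q' *\<^sub>R (w' - w))" unfolding scaleR_scaleR using Q' by simp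
  then have ww: "w' - w = - (1 / Q') *\<^sub>R Y" unfolding wwQ by simp
  \<comment> \<open>At the new slope \<open>e\<close> projects to a negative multiple of
    \<open>Y\<close>, which yields \<open>c = Q^2 * norm Y ^ 2 / Q'\<close>.\<close>
  have xw: "residual w' e = - (Q / Q') *\<^sub>R Y"
    using residual_shift[of w' e w] by (simp add: we ww Q_def)
  have yw: "residual w' f = A - (of_int (fst f) / Q') *\<^sub>R Y"
    using residual_shift[of w' f w] by (simp add: A_def ww)
  define c where "c = Q\<^sup>2 * (norm Y)\<^sup>2 / Q'"
  have nx: "(norm (residual w' e))\<^sup>2 = Q\<^sup>2 * (norm Y)\<^sup>2 / Q'\<^sup>2"
    unfolding xw by (simp add: power_mult_distrib power_divide)
  have c: "c = of_int (fst e') * (norm (residual (slope e') e))\<^sup>2"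
    unfolding nx[unfolded w'_def] c_def using Q' by (simp add: power2_eq_square flip: Q'_def)
  have c12: "c1 < c" "c < c2" using Q'1 Q'2 Q' cc by (simp_all add: c_def field_simps)
  have "c\<^sup>2 < c2\<^sup>2" using c12 cc by (intro power_strict_mono) auto
  then have "1 / c2\<^sup>2 < 1 / c\<^sup>2" using c12 cc by (intro divide_strict_left_mono) auto
  then have rho': "\<rho> < 1 / c\<^sup>2 - 3 / 4" using rho by linarith
  have "inner (residual w' e) (residual w' f) / (norm (residual w' e))\<^sup>2
      = of_int (fst f) / Q - (Q' / Q) * \<theta>"
  proof -
    have "inner (residual w' e) (residual w' f) =
        - (Q / Q') * inner A Y + (Q / Q') * (of_int (fst f) / Q') * (norm Y)\<^sup>2"
      unfolding xw yw power2_norm_eq_inner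
      by (simp add: inner_diff_right inner_commute algebra_simps)
    then show ?thesis unfolding nx \<theta>_def using Q Q' Y0 by (simp add: field_simps power2_eq_square)
  qed
  moreover have "(Q' / Q) * \<theta> = s / Q * \<theta> + of_int a * \<theta>"
    using Q by (simp add: Q'eq field_simps)
  ultimately have tau': "\<bar>inner (residual (slope e') e) (residual (slope e') f)
       / (norm (residual (slope e') e))\<^sup>2 - of_int i - 1 / 2\<bar> \<le> \<rho>"
    using tau by (simp add: w'_def algebra_simps)
  have "real_of_int (2 * fst e) \<le> of_int (fst e')" using big by (simp add: Q_def Q'_def)
  then have qq: "2 * fst e \<le> fst e'" by linarith
  obtain \<epsilon>\<^sub>1 where e1: "0 < \<epsilon>\<^sub>1"
    "\<And>v. norm (v - w') \<le> \<epsilon>\<^sub>1 \<Longrightarrow> inner (v - w') (residual w' e) \<le> 0 \<Longrightarrow> successive v e e'"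
    "\<And>v. norm (v - w') \<le> \<epsilon>\<^sub>1 \<Longrightarrow> of_int (fst e') * (norm (residual v e))\<^sup>2 \<in> {\<alpha>..\<beta>}"
    using successive_near_slope[OF basis' q qq c _ _ _ _ rho(2) rho' tau', of \<alpha> \<beta>] c12 cc rho
    unfolding w'_def by (smt (verit))
  have "w' \<in> region e f \<epsilon>"
  proof -
    \<comment> \<open>Since \<open>Q'\<close> exceeds \<open>Q^2 * norm Y ^ 2 / c2\<close>, this is
      below \<open>c2 / (Q^2 * norm Y)\<close>, and \<open>T\<close> was chosen to make that
      small.\<close>
    have "norm (w' - w) = norm Y / Q'" unfolding ww using Q' by simp
    also have "\<dots> < \<epsilon>"
    proof -
      have "c2 < norm Y * (Q\<^sup>2 * \<epsilon>)"
        using T(4) TY Q eps by (simp add: pos_divide_less_eq) (smt (verit) mult_right_mono zero_le_power2 mult_nonneg_nonneg)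
      then have "c2 * norm Y < norm Y * (Q\<^sup>2 * \<epsilon>) * norm Y" using Y by (intro mult_strict_right_mono) auto
      then have "norm Y < \<epsilon> * (Q\<^sup>2 * (norm Y)\<^sup>2 / c2)"
        using cc by (simp add: field_simps power2_eq_square)
      also have "\<dots> < \<epsilon> * Q'" using Q'1 eps by (intro mult_strict_left_mono)
      finally show ?thesis using Q' by (simp add: field_simps)
    qed
    finally have "norm (w' - w) < \<epsilon>" .
    moreover have "inner (w' - w) A < 0"
      unfolding ww using AY X Q' by (simp add: inner_commute zero_less_divide_iff)
    ultimately show ?thesis by (simp add: region_def w_def A_def)
  qed
  then obtain \<epsilon>\<^sub>2 where e2: "0 < \<epsilon>\<^sub>2" "cball w' \<epsilon>\<^sub>2 \<subseteq> region e f \<epsilon>"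
    using open_region open_contains_cball by meson
  show ?thesis
  proof
    show "lattice_basis e' e f" by (rule basis')
    show "N < fst e'" using big Q by (simp add: Q'_def)
    show "0 < fst e'" using Q' by (simp add: Q'_def)
    show "0 < min \<epsilon>\<^sub>1 \<epsilon>\<^sub>2" using e1 e2 by simp
    show "cball (slope e') (min \<epsilon>\<^sub>1 \<epsilon>\<^sub>2) \<subseteq> region e f \<epsilon>"
      using e2 by (auto simp: w'_def)
    show "successive v e e' \<and> of_int (fst e') * (norm (residual v e))\<^sup>2 \<in> {\<alpha>..\<beta>}"
      if "v \<in> region e' e (min \<epsilon>\<^sub>1 \<epsilon>\<^sub>2)" for v
      using that e1(2,3)[of v] by (auto simp: region_def w'_def)
  qed
qed

section \<open>From chains of successive points to best approximations\<close>

lemma approx_error_le_residual: "approx_error v q \<le> norm (residual v (int q, p))"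
proof -
  have "(dist_nearest_int (real q * v $ i))\<^sup>2 \<le> (residual v (int q, p) $ i)\<^sup>2" for i
  proof -
    have "dist_nearest_int (real q * v $ i) \<le> \<bar>residual v (int q, p) $ i\<bar>"
      using dist_nearest_int_le by (simp add: residual_def)
    then show ?thesis
      by (metis abs_ge_zero dist_nearest_int_def power2_abs power_mono)
  qed
  then have "(approx_error v q)\<^sup>2 \<le> (norm (residual v (int q, p)))\<^sup>2"
    unfolding norm_squared_2 by (simp add: approx_error_def add_mono)
  then show ?thesis by (rule power2_le_imp_le) simp
qed

text \<open>Each coordinate is at least the distance to the nearest integer, so equal sums of
  squares force equality in both coordinates.\<close>

lemma norm_residual_eq_approx_error_iff:
  "norm (residual v (int q, p)) = approx_error v q \<longleftrightarrow>
     \<bar>real q * v $ 1 - of_int (p $ 1)\<bar> = dist_nearest_int (real q * v $ 1) \<and>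
     \<bar>real q * v $ 2 - of_int (p $ 2)\<bar> = dist_nearest_int (real q * v $ 2)"
proof -
  define a1 a2 where "a1 = \<bar>real q * v $ 1 - of_int (p $ 1)\<bar>"
    and "a2 = \<bar>real q * v $ 2 - of_int (p $ 2)\<bar>"
  define d1 d2 where "d1 = dist_nearest_int (real q * v $ 1)"
    and "d2 = dist_nearest_int (real q * v $ 2)"
  have d: "0 \<le> d1" "0 \<le> d2" "d1 \<le> a1" "d2 \<le> a2"
    using dist_nearest_int_le by (simp_all add: a1_def a2_def d1_def d2_def dist_nearest_int_def)
  have sq: "d1\<^sup>2 \<le> a1\<^sup>2" "d2\<^sup>2 \<le> a2\<^sup>2" using d by (auto intro: power_mono)
  have "(norm (residual v (int q, p)))\<^sup>2 = a1\<^sup>2 + a2\<^sup>2"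
    unfolding norm_squared_2 by (simp add: residual_def a1_def a2_def)
  then have "norm (residual v (int q, p)) = sqrt (a1\<^sup>2 + a2\<^sup>2)"
    by (metis norm_ge_zero real_sqrt_unique)
  moreover have "approx_error v q = sqrt (d1\<^sup>2 + d2\<^sup>2)"
    by (simp add: approx_error_def d1_def d2_def)
  moreover have "a1\<^sup>2 + a2\<^sup>2 = d1\<^sup>2 + d2\<^sup>2 \<longleftrightarrow> a1 = d1 \<and> a2 = d2"
  proof
    assume "a1\<^sup>2 + a2\<^sup>2 = d1\<^sup>2 + d2\<^sup>2"
    then have "a1\<^sup>2 = d1\<^sup>2" "a2\<^sup>2 = d2\<^sup>2" using sq by linarith+
    then show "a1 = d1 \<and> a2 = d2" using d by (auto intro: power2_eq_imp_eq)
  qed simp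
  ultimately show ?thesis unfolding a1_def a2_def d1_def d2_def by simp
qed

lemma approx_error_attained: "\<exists>p. norm (residual v (int q, p)) = approx_error v q"
  unfolding norm_residual_eq_approx_error_iff
  by (rule exI[of _ "\<chi> i. round (real q * v $ i)"]) (simp add: dist_nearest_int_def)

lemma successive_le_approx_error:
  assumes "successive v e e'" "0 < q" "int q < fst e'"
  shows "norm (residual v e) \<le> approx_error v q"
  using assms approx_error_attained[of v q] unfolding successive_def
  by (metis fst_conv of_nat_0_less_iff)

lemma successive_approx_error:
  assumes "successive v e e'"
  shows "norm (residual v e) = approx_error v (nat (fst e))"
proof (rule antisym)
  have q: "0 < fst e" "fst e < fst e'" using assms by (auto simp: successive_def)
  then show "norm (residual v e) \<le> approx_error v (nat (fst e))"
    using successive_le_approx_error[OF assms] by simp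
  show "approx_error v (nat (fst e)) \<le> norm (residual v e)"
    using approx_error_le_residual[of v "nat (fst e)" "snd e"] q by simp
qed

context
  fixes v :: "real ^ 2" and z :: "nat \<Rightarrow> lpoint"
  assumes start: "fst (z 0) = 1" and succ: "\<And>n. successive v (z n) (z (Suc n))"
begin

lemma fst_pos: "0 < fst (z n)"
  using succ[of n] by (simp add: successive_def)

lemma next_better_denom:
  "nat (fst (z (Suc n))) \<in> better_denoms v (nat (fst (z n)))"
  using succ[of n] fst_pos[of "Suc n"] unfolding better_denoms_def
  by (simp add: successive_def flip: successive_approx_error[OF succ])

lemma next_better_denom_least:
  assumes "m \<in> better_denoms v (nat (fst (z n)))"
  shows "nat (fst (z (Suc n))) \<le> m"
proof (rule ccontr)
  assume "\<not> ?thesis"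
  then have "int m < fst (z (Suc n))" by linarith
  then show False
    using assms successive_le_approx_error[OF succ[of n], of m] unfolding better_denoms_def
    by (simp flip: successive_approx_error[OF succ])
qed

lemma infinite_best_approx_seq_of_successive:
  "infinite_best_approx_seq v (\<lambda>n. nat (fst (z n))) (\<lambda>n. snd (z n))"
proof -
  have "norm (residual v (int (nat (fst (z n))), snd (z n))) = approx_error v (nat (fst (z n)))" for n
    using successive_approx_error[OF succ[of n]] fst_pos[of n] by simp
  then show ?thesis
    unfolding infinite_best_approx_seq_def norm_residual_eq_approx_error_iff
    using start next_better_denom next_better_denom_least by auto
qed

text \<open>A least element is unique, so the recursion determines \<open>q\<close>. Ties may change
  \<open>p\<close>, hence only the norms of the residuals are compared.\<close>

lemma infinite_best_approx_seq_unique: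
  assumes "infinite_best_approx_seq v q p"
  shows "q n = nat (fst (z n))"
    and "norm (real (q n) *\<^sub>R v - int_vec (p n)) = norm (residual v (z n))"
proof -
  have bas: "q 0 = 1" "q (Suc n) \<in> better_denoms v (q n)"
    "\<forall>m \<in> better_denoms v (q n). q (Suc n) \<le> m" for n
    using assms by (auto simp: infinite_best_approx_seq_def)
  show q: "q n = nat (fst (z n))" for n
  proof (induction n)
    case 0
    show ?case using bas(1) start by simp
  next
    case (Suc n)
    show ?case
      using bas(2,3)[of n] next_better_denom[of n] next_better_denom_least[of _ n]
      unfolding Suc by (intro antisym) auto
  qed
  have "norm (residual v (int (q n), p n)) = approx_error v (q n)"
    unfolding norm_residual_eq_approx_error_iff
    using assms by (auto simp: infinite_best_approx_seq_def)
  then show "norm (real (q n) *\<^sub>R v - int_vec (p n)) = norm (residual v (z n))"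
    unfolding successive_approx_error[OF succ] q[symmetric] by (simp add: residual_def)
qed

end

section \<open>A binary tree of choices and its limit vectors\<close>

text \<open>At stage \<open>n\<close> the branch \<open>S\<close> takes one of two successors with different values of \<open>h\<close>,
  according to whether \<open>n \<in> S\<close>.\<close>

lemma branching_choice:
  fixes P :: "'s \<Rightarrow> bool" and h :: "'s \<Rightarrow> int"
  assumes P0: "P s0" and step: "\<And>n s N. P s \<Longrightarrow> \<exists>s'. P s' \<and> R n s s' \<and> N < h s'"
  shows "\<exists>st :: nat set \<Rightarrow> nat \<Rightarrow> 's.
    (\<forall>S. st S 0 = s0 \<and> (\<forall>n. P (st S n) \<and> R n (st S n) (st S (Suc n)))) \<and>
    (\<forall>S S'. (\<forall>n. h (st S n) = h (st S' n)) \<longrightarrow> S = S')"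
proof -
  define nxt where "nxt n N s = (SOME s'. P s' \<and> R n s s' \<and> N < h s')" for n N s
  have nxt: "P (nxt n N s) \<and> R n s (nxt n N s) \<and> N < h (nxt n N s)" if "P s" for n N s
    unfolding nxt_def by (rule someI_ex) (rule step[OF that])
  \<comment> \<open>The alternative successor is required to have \<open>h\<close> above that of the
    default one, so the two can be told apart by \<open>h\<close>.\<close>
  define br where "br b n s = (if b then nxt n (h (nxt n 0 s)) s else nxt n 0 s)" for b n s
  define st where "st S = rec_nat s0 (\<lambda>n. br (n \<in> S) n)" for S
  have st0: "st S 0 = s0" and stS: "st S (Suc n) = br (n \<in> S) n (st S n)" for S n
    by (simp_all add: st_def)
  have P: "P (st S n)" for S n
    by (induction n) (auto simp: st0 stS br_def P0 nxt)
  have "S = S'" if eq: "\<forall>n. h (st S n) = h (st S' n)" for S S'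
  proof -
    \<comment> \<open>Equality of states is carried along: from a common state, the next value of
      \<open>h\<close> reveals whether \<open>n\<close> was taken.\<close>
    have "(\<forall>m<n. m \<in> S \<longleftrightarrow> m \<in> S') \<and> st S n = st S' n" for n
    proof (induction n)
      case 0
      show ?case by (simp add: st0)
    next
      case (Suc n)
      have "h (nxt n 0 (st S n)) < h (nxt n (h (nxt n 0 (st S n))) (st S n))"
        using nxt[OF P] by blast
      then have "n \<in> S \<longleftrightarrow> n \<in> S'"
        using eq[rule_format, of "Suc n"] Suc by (auto simp: stS br_def split: if_splits)
      then show ?case using Suc by (auto simp: stS less_Suc_eq)
    qed
    then show ?thesis by blast
  qed
  moreover have "R n (st S n) (st S (Suc n))" for S n
    using P nxt by (auto simp: stS br_def)
  ultimately show ?thesis using st0 P by (intro exI[of _ st]) auto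
qed

lemma nested_cball_point:
  fixes c :: "nat \<Rightarrow> 'a::heine_borel"
  assumes "\<And>n. 0 \<le> r n" and "\<And>n. cball (c (Suc n)) (r (Suc n)) \<subseteq> cball (c n) (r n)"
  shows "\<exists>x. \<forall>n. x \<in> cball (c n) (r n)"
proof -
  have "\<Inter>(range (\<lambda>n. cball (c n) (r n))) \<noteq> {}"
  proof (rule compact_nest)
    show "cball (c n) (r n) \<subseteq> cball (c m) (r m)" if "m \<le> n" for m n
      using that by (rule lift_Suc_antimono_le[rotated]) (rule assms)
  qed (simp_all add: assms not_less)
  then show ?thesis by blast
qed

lemma region_subset_cball: "region e f \<epsilon> \<subseteq> cball (slope e) \<epsilon>"
  by (auto simp: region_def dist_norm norm_minus_commute)

lemma lattice_basis_standard: "lattice_basis (1, 0) (0, vector [1, 0]) (0, vector [0, 1])"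
proof -
  have "z = smul (fst z) (1, 0) + smul (snd z $ 1) (0, vector [1, 0]) + smul (snd z $ 2) (0, vector [0, 1])"
    for z :: lpoint
    by (simp add: smul_def prod_eq_iff vec_eq_iff forall_2)
  then have "\<exists>i j l. z = smul i (1, 0) + smul j (0, vector [1, 0]) + smul l (0, vector [0, 1])"
    for z :: lpoint by blast
  then show ?thesis by (simp add: lattice_basis_def det3_def)
qed

theorem theorem3:
  fixes \<Delta> :: "nat \<Rightarrow> real set"
  assumes "\<And>n. n \<ge> 1 \<Longrightarrow> \<exists>a b. a < b \<and> \<Delta> n = {a..b}"
    and "\<And>n. n \<ge> 1 \<Longrightarrow> \<Delta> n \<subseteq> {0..2 / sqrt 3}"
  shows "\<exists>S :: (real ^ 2) set. S \<approx> (UNIV :: real set) \<and>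
    (\<forall>v\<in>S.
      (\<exists>q p. infinite_best_approx_seq v q p) \<and>
      (\<forall>q p. infinite_best_approx_seq v q p \<longrightarrow>
        (\<forall>n\<ge>1.
          1 / pi * cyl_volume v q p n =
            real (q n) * (norm (real (q (n - 1)) *\<^sub>R v - int_vec (p (n - 1))))\<^sup>2 \<and>
          1 / pi * cyl_volume v q p n \<in> \<Delta> n)))"
proof -
  define P :: "lpoint \<times> lpoint \<times> lpoint \<times> real \<Rightarrow> bool" where
    "P = (\<lambda>(e, f, g, \<epsilon>). lattice_basis e f g \<and> 0 < fst e \<and> 0 < \<epsilon>)"
  \<comment> \<open>Stage \<open>n\<close> passes from \<open>z n\<close> to
    \<open>z (Suc n)\<close>, which is the volume of index \<open>Suc n\<close>. Closed balls inside
    the previous half disc are demanded because the open half discs alone need not have a common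
    point.\<close>
  define R :: "nat \<Rightarrow> lpoint \<times> lpoint \<times> lpoint \<times> real \<Rightarrow> lpoint \<times> lpoint \<times> lpoint \<times> real \<Rightarrow> bool" where
    "R n = (\<lambda>(e, f, g, \<epsilon>) (e', f', g', \<epsilon>'). f' = e \<and> cball (slope e') \<epsilon>' \<subseteq> region e f \<epsilon> \<and>
       (\<forall>v\<in>region e' f' \<epsilon>'. successive v e e' \<and>
          of_int (fst e') * (norm (residual v e))\<^sup>2 \<in> \<Delta> (Suc n)))" for n
  \<comment> \<open>Height 1 gives the denominator \<open>q 0 = 1\<close>; the slope is 0.\<close>
  define s0 :: "lpoint \<times> lpoint \<times> lpoint \<times> real" where
    "s0 = ((1, 0), (0, vector [1, 0]), (0, vector [0, 1]), 1)"
  have P0: "P s0" using lattice_basis_standard by (simp add: P_def s0_def)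
  have step: "\<exists>s'. P s' \<and> R n s s' \<and> N < fst (fst s')" if Ps: "P s" for n s N
  proof -
    obtain e f g \<epsilon> where s: "s = (e, f, g, \<epsilon>)" by (cases s)
    obtain \<alpha> \<beta> where ab: "\<alpha> < \<beta>" "\<Delta> (Suc n) = {\<alpha>..\<beta>}" using assms(1)[of "Suc n"] by auto
    have "0 \<le> \<alpha>" "\<beta> \<le> 2 / sqrt 3" using assms(2)[of "Suc n"] ab by auto
    then obtain e' \<epsilon>' where "lattice_basis e' e f" "N < fst e'" "0 < fst e'" "0 < \<epsilon>'"
      "cball (slope e') \<epsilon>' \<subseteq> region e f \<epsilon>"
      "\<And>v. v \<in> region e' e \<epsilon>' \<Longrightarrow>
        successive v e e' \<and> of_int (fst e') * (norm (residual v e))\<^sup>2 \<in> {\<alpha>..\<beta>}"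
      using next_point_exists[of e f g \<epsilon> \<alpha> \<beta> N] Ps ab(1) unfolding P_def s by auto
    then have "P (e', e, f, \<epsilon>') \<and> R n s (e', e, f, \<epsilon>') \<and> N < fst (fst (e', e, f, \<epsilon>'))"
      unfolding P_def R_def s ab(2) by auto
    then show ?thesis by blast
  qed
  have "\<exists>st :: nat set \<Rightarrow> nat \<Rightarrow> _.
     (\<forall>S. st S 0 = s0 \<and> (\<forall>n. P (st S n) \<and> R n (st S n) (st S (Suc n)))) \<and>
     (\<forall>S S'. (\<forall>n. fst (fst (st S n)) = fst (fst (st S' n))) \<longrightarrow> S = S')"
    by (rule branching_choice[where h = "\<lambda>s. fst (fst s)"]) (fact P0, erule step)
  then obtain st :: "nat set \<Rightarrow> nat \<Rightarrow> _" where tree: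
    "(\<forall>S. st S 0 = s0 \<and> (\<forall>n. P (st S n) \<and> R n (st S n) (st S (Suc n)))) \<and>
     (\<forall>S S'. (\<forall>n. fst (fst (st S n)) = fst (fst (st S' n))) \<longrightarrow> S = S')"
    by (rule exE)
  have st: "st S 0 = s0" "P (st S n)" "R n (st S n) (st S (Suc n))" for S n
    using tree by simp_all
  define z where "z S n = fst (st S n)" for S n
  define y where "y S n = fst (snd (st S n))" for S n
  define r where "r S n = snd (snd (snd (st S n)))" for S n
  have nest: "cball (slope (z S (Suc n))) (r S (Suc n)) \<subseteq> region (z S n) (y S n) (r S n)"
    and good: "\<And>v. v \<in> region (z S (Suc n)) (y S (Suc n)) (r S (Suc n)) \<Longrightarrow>
      successive v (z S n) (z S (Suc n)) \<and>
      of_int (fst (z S (Suc n))) * (norm (residual v (z S n)))\<^sup>2 \<in> \<Delta> (Suc n)" for S n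
    using st(3)[of n S] by (auto simp: R_def z_def y_def r_def case_prod_beta)
  have "0 \<le> r S n" for S n
    using st(2)[of S n] by (auto simp: P_def r_def case_prod_beta)
  then have "\<exists>v. \<forall>n. v \<in> cball (slope (z S n)) (r S n)" for S
    using nest region_subset_cball by (intro nested_cball_point) blast+
  then obtain V where V: "\<And>S n. V S \<in> cball (slope (z S n)) (r S n)" by metis
  have start: "fst (z S 0) = 1" for S by (simp add: z_def st s0_def)
  \<comment> \<open>Ball \<open>Suc n\<close> lies inside half disc \<open>n\<close>, so the limit
    lies in every open half disc and not merely in its closure.\<close>
  have "V S \<in> region (z S n) (y S n) (r S n)" for S n using V nest by blast
  then have succ: "successive (V S) (z S n) (z S (Suc n))"
    and vol: "of_int (fst (z S (Suc n))) * (norm (residual (V S) (z S n)))\<^sup>2 \<in> \<Delta> (Suc n)" for S n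
    using good by blast+
  note bas = infinite_best_approx_seq_of_successive[of "z S" "V S" for S, OF start succ]
  note uni = infinite_best_approx_seq_unique[of "z S" "V S" for S, OF start succ]
  \<comment> \<open>A vector determines its denominators, and these determine the branch of the
    tree.\<close>
  have "inj V"
  proof (rule injI)
    fix S S' assume "V S = V S'"
    then have "nat (fst (z S n)) = nat (fst (z S' n))" for n
      using uni(1)[of S'] bas[of S] by metis
    moreover have "0 < fst (z S n)" for S n using succ[of S n] by (simp add: successive_def)
    ultimately have "fst (z S n) = fst (z S' n)" for n
      by (metis int_nat_eq less_imp_le)
    then show "S = S'" unfolding z_def using tree by simp
  qed
  then have "range V \<approx> (UNIV :: real set)"
    using inj_on_image_eqpoll_self nat_sets_eqpoll_reals eqpoll_trans by blast
  moreover have "1 / pi * cyl_volume (V S) q p n =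
        real (q n) * (norm (real (q (n - 1)) *\<^sub>R V S - int_vec (p (n - 1))))\<^sup>2 \<and>
      1 / pi * cyl_volume (V S) q p n \<in> \<Delta> n"
    if sq: "infinite_best_approx_seq (V S) q p" and n: "1 \<le> n" for S q p n
  proof -
    obtain m where m: "n = Suc m" using n by (cases n) auto
    have "1 / pi * cyl_volume (V S) q p n =
        real (q n) * (norm (real (q (n - 1)) *\<^sub>R V S - int_vec (p (n - 1))))\<^sup>2"
      by (simp add: cyl_volume_def cyl_radius_def)
    moreover have "0 < fst (z S n)" using succ[of S n] by (simp add: successive_def)
    then have "real (q n) = of_int (fst (z S n))" using uni(1)[OF sq, of n] by simp
    ultimately show ?thesis using vol[of S m] uni(2)[OF sq, of m] by (simp add: m)
  qed
  ultimately show ?thesis using bas by (intro exI[of _ "range V"]) blast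
qed

end
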